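(* Let $a_1,a_2,a_3$ be three non-collinear non-null points, and let $a_0$ be a non-null point distinct from $a_1,a_2,a_3$. Suppose that the lines $a_0a_1$, $a_0a_2$, $a_0a_3$ are non-null and meet the lines $a_2a_3$, $a_1a_3$, $a_1a_2$ respectively at the points $d_1,d_2,d_3$, and that $d_1,d_2,d_3$ are non-null. Define the quadrances $$r_1\equiv q(a_2,d_1),\quad t_1\equiv q(d_1,a_3),\quad r_2\equiv q(a_3,d_2),\quad t_2\equiv q(d_2,a_1),\quad r_3\equiv q(a_1,d_3),\quad t_3\equiv q(d_3,a_2).$$ Then $$r_1r_2r_3=t_1t_2t_3.$$
   Context: Let $\mathbb F$ be a field of characteristic not two. A 3-proportion $x:y:z$ is a triple of elements of $\mathbb F$, not all zero, up to a common non-zero scalar. A point $a=[x:y:z]$ and a line $L=(l:m:n)$ are both 3-proportions. The point $[x:y:z]$ lies on the line $(l:m:n)$ when $lx+my-nz=0$. For distinct points $a,b$, the join $ab$ is the unique line through both; distinct lines meet in the unique point lying on both. A point $[x:y:z]$ is null when $x^2+y^2-z^2=0$; a line $(l:m:n)$ is null when $l^2+m^2-n^2=0$. The quadrance between non-null points $a_1=[x_1:y_1:z_1]$, $a_2=[x_2:y_2:z_2]$ is $$q(a_1,a_2)=1-\frac{(x_1x_2+y_1y_2-z_1z_2)^2}{(x_1^2+y_1^2-z_1^2)(x_2^2+y_2^2-z_2^2)};$$ it is undefined if either point is null. *)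

theory Defs
  imports Main
begin

definition proportional :: "'a::field \<times> 'a \<times> 'a \<Rightarrow> 'a \<times> 'a \<times> 'a \<Rightarrow> bool" where
  "proportional u v \<longleftrightarrow>
     u \<noteq> (0, 0, 0) \<and> v \<noteq> (0, 0, 0) \<and>
     (\<exists>c. c \<noteq> 0 \<and> (case u of (x, y, z) \<Rightarrow> v = (c * x, c * y, c * z)))"

lemma part_equivp_proportional: "part_equivp (proportional :: 'a::field \<times> 'a \<times> 'a \<Rightarrow> _)"
proof (rule part_equivpI)
  have "proportional (1, 0, 0) ((1, 0, 0) :: 'a \<times> 'a \<times> 'a)"
    by (auto simp: proportional_def intro!: exI[of _ 1])
  then show "\<exists>u :: 'a \<times> 'a \<times> 'a. proportional u u" by blast
  show "symp (proportional :: 'a \<times> 'a \<times> 'a \<Rightarrow> _)"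
  proof (rule sympI)
    fix u v :: "'a \<times> 'a \<times> 'a"
    assume "proportional u v"
    then obtain c x y z where
      "c \<noteq> 0" "u = (x, y, z)" "v = (c * x, c * y, c * z)" "u \<noteq> (0, 0, 0)" "v \<noteq> (0, 0, 0)"
      by (cases u) (auto simp: proportional_def)
    then show "proportional v u"
      unfolding proportional_def by (auto intro!: exI[of _ "inverse c"])
  qed
  show "transp (proportional :: 'a \<times> 'a \<times> 'a \<Rightarrow> _)"
  proof (rule transpI)
    fix u v w :: "'a \<times> 'a \<times> 'a"
    assume "proportional u v" "proportional v w"
    then obtain c d x y z where
      "c \<noteq> 0" "d \<noteq> 0" "u = (x, y, z)" "w = (d * (c * x), d * (c * y), d * (c * z))"
      "u \<noteq> (0, 0, 0)" "w \<noteq> (0, 0, 0)"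
      by (cases u) (auto simp: proportional_def)
    then show "proportional u w"
      unfolding proportional_def by (auto intro!: exI[of _ "d * c"] simp: mult.assoc)
  qed
qed

quotient_type (overloaded) 'a proportion = "'a::field \<times> 'a \<times> 'a" / partial: proportional
  by (rule part_equivp_proportional)

type_synonym 'a point = "'a proportion"
type_synonym 'a line = "'a proportion"

lift_definition lies_on :: "'a::field point \<Rightarrow> 'a line \<Rightarrow> bool"
  is "\<lambda>(x, y, z) (l, m, n). l * x + m * y - n * z = 0"
proof -
  fix p p' L L' :: "'a \<times> 'a \<times> 'a"
  assume "proportional p p'" "proportional L L'"
  then obtain c d x y z l m n where
    *: "c \<noteq> 0" "d \<noteq> 0" "p = (x, y, z)" "p' = (c * x, c * y, c * z)"
       "L = (l, m, n)" "L' = (d * l, d * m, d * n)"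
    by (cases p, cases L) (auto simp: proportional_def)
  have eq: "d * l * (c * x) + d * m * (c * y) - d * n * (c * z) = c * d * (l * x + m * y - n * z)"
    by (simp add: algebra_simps)
  show "(case p of (x, y, z) \<Rightarrow> \<lambda>(l, m, n). l * x + m * y - n * z = 0) L =
    (case p' of (x, y, z) \<Rightarrow> \<lambda>(l, m, n). l * x + m * y - n * z = 0) L'"
    unfolding *(3-6) prod.case eq using *(1,2) by simp
qed

text \<open>The condition is the same for points and for lines.\<close>

lift_definition null :: "'a::field proportion \<Rightarrow> bool"
  is "\<lambda>(x, y, z). x\<^sup>2 + y\<^sup>2 - z\<^sup>2 = 0"
proof -
  fix p p' :: "'a \<times> 'a \<times> 'a"
  assume "proportional p p'"
  then obtain c x y z where
    *: "c \<noteq> 0" "p = (x, y, z)" "p' = (c * x, c * y, c * z)"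
    by (cases p) (auto simp: proportional_def)
  have eq: "(c * x)\<^sup>2 + (c * y)\<^sup>2 - (c * z)\<^sup>2 = c\<^sup>2 * (x\<^sup>2 + y\<^sup>2 - z\<^sup>2)"
    by (simp add: algebra_simps)
  show "(case p of (x, y, z) \<Rightarrow> x\<^sup>2 + y\<^sup>2 - z\<^sup>2 = 0) =
    (case p' of (x, y, z) \<Rightarrow> x\<^sup>2 + y\<^sup>2 - z\<^sup>2 = 0)"
    unfolding *(2,3) prod.case eq using *(1) by simp
qed

text \<open>Meaningful only for non-null arguments; if one is null, division by zero makes the value 1.\<close>

lift_definition quadrance :: "'a::field point \<Rightarrow> 'a point \<Rightarrow> 'a"
  is "\<lambda>(x1, y1, z1) (x2, y2, z2).
    1 - (x1 * x2 + y1 * y2 - z1 * z2)\<^sup>2 /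
        ((x1\<^sup>2 + y1\<^sup>2 - z1\<^sup>2) * (x2\<^sup>2 + y2\<^sup>2 - z2\<^sup>2))"
proof -
  fix p p' q q' :: "'a \<times> 'a \<times> 'a"
  assume "proportional p p'" "proportional q q'"
  then obtain c d x1 y1 z1 x2 y2 z2 where
    *: "c \<noteq> 0" "d \<noteq> 0" "p = (x1, y1, z1)" "p' = (c * x1, c * y1, c * z1)"
       "q = (x2, y2, z2)" "q' = (d * x2, d * y2, d * z2)"
    by (cases p, cases q) (auto simp: proportional_def)
  have num: "(c * x1 * (d * x2) + c * y1 * (d * y2) - c * z1 * (d * z2))\<^sup>2 =
    (c * d)\<^sup>2 * (x1 * x2 + y1 * y2 - z1 * z2)\<^sup>2"
    by (simp add: power2_eq_square algebra_simps)
  have den: "((c * x1)\<^sup>2 + (c * y1)\<^sup>2 - (c * z1)\<^sup>2) * ((d * x2)\<^sup>2 + (d * y2)\<^sup>2 - (d * z2)\<^sup>2) =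
    (c * d)\<^sup>2 * ((x1\<^sup>2 + y1\<^sup>2 - z1\<^sup>2) * (x2\<^sup>2 + y2\<^sup>2 - z2\<^sup>2))"
    by (simp add: power2_eq_square algebra_simps)
  from \<open>c \<noteq> 0\<close> \<open>d \<noteq> 0\<close> have "(c * d)\<^sup>2 \<noteq> 0" by simp
  then show "(case p of (x1, y1, z1) \<Rightarrow> \<lambda>(x2, y2, z2).
      1 - (x1 * x2 + y1 * y2 - z1 * z2)\<^sup>2 /
        ((x1\<^sup>2 + y1\<^sup>2 - z1\<^sup>2) * (x2\<^sup>2 + y2\<^sup>2 - z2\<^sup>2))) q =
    (case p' of (x1, y1, z1) \<Rightarrow> \<lambda>(x2, y2, z2).
      1 - (x1 * x2 + y1 * y2 - z1 * z2)\<^sup>2 /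
        ((x1\<^sup>2 + y1\<^sup>2 - z1\<^sup>2) * (x2\<^sup>2 + y2\<^sup>2 - z2\<^sup>2))) q'"
    unfolding *(3-6) prod.case num den by simp
qed

definition collinear :: "'a::field point \<Rightarrow> 'a point \<Rightarrow> 'a point \<Rightarrow> bool" where
  "collinear a b c \<longleftrightarrow> (\<exists>L. lies_on a L \<and> lies_on b L \<and> lies_on c L)"

definition join :: "'a::field point \<Rightarrow> 'a point \<Rightarrow> 'a line" where
  "join a b = (THE L. lies_on a L \<and> lies_on b L)"

definition meet :: "'a::field line \<Rightarrow> 'a line \<Rightarrow> 'a point" where
  "meet L M = (THE a. lies_on a L \<and> lies_on a M)"

text \<open>The descriptions are proper for distinct arguments.\<close>

lemma proportional_iff_minors:
  assumes "(x, y, z) \<noteq> (0, 0, 0 :: 'a::field)" "(x', y', z') \<noteq> (0, 0, 0)"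
  shows "proportional (x, y, z) (x', y', z') \<longleftrightarrow>
    y * z' = z * y' \<and> z * x' = x * z' \<and> x * y' = y * x'"
proof
  assume "proportional (x, y, z) (x', y', z')"
  then show "y * z' = z * y' \<and> z * x' = x * z' \<and> x * y' = y * x'"
    by (auto simp: proportional_def)
next
  assume *: "y * z' = z * y' \<and> z * x' = x * z' \<and> x * y' = y * x'"
  consider "x \<noteq> 0" | "y \<noteq> 0" | "z \<noteq> 0" using assms(1) by auto
  then have "\<exists>c. x' = c * x \<and> y' = c * y \<and> z' = c * z"
  proof cases
    case 1
    then show ?thesis using * by (intro exI[of _ "x' / x"]) (simp add: field_simps)
  next
    case 2
    then show ?thesis using * by (intro exI[of _ "y' / y"]) (simp add: field_simps)
  next
    case 3
    then show ?thesis using * by (intro exI[of _ "z' / z"]) (simp add: field_simps)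
  qed
  then show "proportional (x, y, z) (x', y', z')"
    using assms by (auto simp: proportional_def)
qed

lemma proportional_refl_iff: "proportional u u \<longleftrightarrow> u \<noteq> (0, 0, 0)"
  by (cases u) (auto simp: proportional_def intro!: exI[of _ 1])

lemma ex1_line:
  fixes a b :: "'a::field point"
  assumes "a \<noteq> b"
  shows "\<exists>!L. lies_on a L \<and> lies_on b L"
proof -
  have "\<exists>L. lies_on a L \<and> lies_on b L \<and> (\<forall>M. lies_on a M \<and> lies_on b M \<longrightarrow> L = M)"
    using assms
  proof (transfer, goal_cases)
    case (1 a b)
    obtain x1 y1 z1 x2 y2 z2 where ab: "a = (x1, y1, z1)" "b = (x2, y2, z2)"
      by (cases a, cases b)
    let ?l = "y1 * z2 - z1 * y2" and ?m = "z1 * x2 - x1 * z2" and ?n = "y1 * x2 - x1 * y2"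
    have nz: "(x1, y1, z1) \<noteq> (0, 0, 0)" "(x2, y2, z2) \<noteq> (0, 0, 0)"
      using 1(1,2) by (auto simp: ab proportional_refl_iff)
    have L: "(?l, ?m, ?n) \<noteq> (0, 0, 0)"
      using 1(3) proportional_iff_minors[OF nz] by (auto simp: ab)
    have "proportional (?l, ?m, ?n) (l, m, n)"
      if "(l, m, n) \<noteq> (0, 0, 0)"
        and e: "l * x1 + m * y1 - n * z1 = 0" "l * x2 + m * y2 - n * z2 = 0" for l m n
      unfolding proportional_iff_minors[OF L that(1)]
      using e by (intro conjI; algebra)
    moreover have "?l * x1 + ?m * y1 - ?n * z1 = 0" "?l * x2 + ?m * y2 - ?n * z2 = 0"
      by (auto simp: algebra_simps)
    ultimately show ?case
      using L unfolding ab
      by (intro rev_bexI[of "(?l, ?m, ?n)"]) (auto simp: Respects_def proportional_refl_iff)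
  qed
  then show ?thesis by blast
qed

lemma lies_on_sym: "lies_on a L \<longleftrightarrow> lies_on L a"
  by transfer (auto simp: algebra_simps)

lemma ex1_point:
  fixes L M :: "'a::field line"
  assumes "L \<noteq> M"
  shows "\<exists>!a. lies_on a L \<and> lies_on a M"
  using ex1_line[OF assms] by (simp add: lies_on_sym)

end

theory Submission
  imports Defs "HOL-Library.Product_Plus"
begin

text \<open>
  Choose representing vectors and write \<open>a0 = x1 a1 + x2 a2 + x3 a3\<close>. Then
  \<open>d1 = x2 a2 + x3 a3\<close>, and cyclically. For \<open>d = \<alpha> u + \<beta> v\<close> the quadrance between \<open>u\<close> and \<open>d\<close>
  is \<open>\<beta>\<^sup>2\<close> times the Gram determinant of \<open>u, v\<close>, divided by the values of the quadratic form at
  \<open>u\<close> and \<open>d\<close>. Hence both products are \<open>(x1 x2 x3)\<^sup>2\<close> times the three Gram determinants, divided by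
  the values of the form at \<open>a1, a2, a3, d1, d2, d3\<close>.
\<close>

text \<open>The line equation carries the same minus sign on the third coordinate as the quadratic
  form. So this one bilinear form expresses incidence, nullity and quadrance alike.\<close>

fun bil :: "'a::field \<times> 'a \<times> 'a \<Rightarrow> 'a \<times> 'a \<times> 'a \<Rightarrow> 'a" where
  "bil (x, y, z) (x', y', z') = x * x' + y * y' - z * z'"

fun scale :: "'a::field \<Rightarrow> 'a \<times> 'a \<times> 'a \<Rightarrow> 'a \<times> 'a \<times> 'a" (infixr "*s" 75) where
  "c *s (x, y, z) = (c * x, c * y, c * z)"

abbreviation pt :: "'a::field \<times> 'a \<times> 'a \<Rightarrow> 'a proportion" where
  "pt \<equiv> abs_proportion"

lemma bil_commute: "bil u v = bil v u"
  by (cases u; cases v) (simp add: mult.commute)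

lemma bil_add_left: "bil (u + v) w = bil u w + bil v w"
  by (cases u; cases v; cases w) (simp add: algebra_simps)

lemma bil_scale_left: "bil (c *s u) w = c * bil u w"
  by (cases u; cases w) (simp add: algebra_simps)

lemma bil_add_right: "bil w (u + v) = bil w u + bil w v"
  by (metis bil_add_left bil_commute)

lemma bil_scale_right: "bil w (c *s u) = c * bil w u"
  by (metis bil_scale_left bil_commute)

lemmas bil_simps = bil_add_left bil_scale_left bil_add_right bil_scale_right

lemma proportional_refl: "u \<noteq> 0 \<Longrightarrow> proportional u u"
  by (simp add: proportional_refl_iff zero_prod_def)

text \<open>The quotient is partial, and a triple is proportional to itself only if it is nonzero.
  Hence representatives are nonzero, and the geometry can be done with nonzero vectors.\<close>

lemma proportion_cases:
  obtains v where "v \<noteq> 0" "p = pt v"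
proof -
  have "proportional (rep_proportion p) (rep_proportion p)"
    using Quotient3_rep_reflp[OF Quotient3_proportion] .
  moreover have "p = pt (rep_proportion p)"
    using Quotient3_abs_rep[OF Quotient3_proportion, of p] by (rule sym)
  ultimately show thesis
    using that by (auto simp: proportional_refl_iff zero_prod_def)
qed

lemma pt_eq_iff:
  assumes "u \<noteq> 0" "v \<noteq> 0"
  shows "pt u = pt v \<longleftrightarrow> proportional u v"
  using Quotient3_rel[OF Quotient3_proportion, of u v] proportional_refl assms by blast

lemma pt_scale:
  assumes "c \<noteq> 0" "u \<noteq> 0"
  shows "pt (c *s u) = pt u"
proof -
  obtain x y z where u: "u = (x, y, z)" by (cases u)
  have "proportional u (c *s u)"
    using assms by (auto simp: u proportional_def zero_prod_def)
  moreover have "c *s u \<noteq> 0"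
    using assms by (auto simp: u zero_prod_def)
  ultimately show ?thesis
    using assms pt_eq_iff by metis
qed

lemma lies_on_pt:
  assumes "u \<noteq> 0" "l \<noteq> 0"
  shows "lies_on (pt u) (pt l) \<longleftrightarrow> bil u l = 0"
  using assms
  by (cases u; cases l) (simp add: lies_on.abs_eq proportional_refl eq_onp_def mult.commute)

lemma null_pt: "u \<noteq> 0 \<Longrightarrow> null (pt u) \<longleftrightarrow> bil u u = 0"
  by (cases u) (simp add: null.abs_eq proportional_refl eq_onp_def power2_eq_square)

lemma quadrance_pt:
  assumes "u \<noteq> 0" "v \<noteq> 0"
  shows "quadrance (pt u) (pt v) = 1 - (bil u v)\<^sup>2 / (bil u u * bil v v)"
  using assms
  by (cases u; cases v) (simp add: quadrance.abs_eq proportional_refl eq_onp_def power2_eq_square)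

lemma quadrance_commute: "quadrance a b = quadrance b a"
  by (rule proportion_cases[of a], rule proportion_cases[of b])
    (simp add: quadrance_pt bil_commute mult.commute)

text \<open>The Gram determinant of \<open>u\<close> and \<open>d\<close> ignores the multiple of
  \<open>u\<close> contained in \<open>d\<close> and is quadratic in the remaining part
  \<open>\<beta> *s v\<close>.\<close>

lemma quadrance_combination:
  assumes "u \<noteq> 0" "d \<noteq> 0" "bil u u \<noteq> 0" "bil d d \<noteq> 0" and d: "d = \<alpha> *s u + \<beta> *s v"
  shows "quadrance (pt u) (pt d) =
    \<beta>\<^sup>2 * (bil u u * bil v v - (bil u v)\<^sup>2) / (bil u u * bil d d)"
proof -
  have "bil u u * bil d d - (bil u d)\<^sup>2 = \<beta>\<^sup>2 * (bil u u * bil v v - (bil u v)\<^sup>2)"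
    by (simp add: d bil_simps bil_commute[of v u] power2_eq_square algebra_simps)
  then show ?thesis
    using assms(1-4) by (simp add: quadrance_pt diff_divide_eq_iff)
qed

text \<open>Allowing \<open>a = b\<close> gives that non-collinear points are distinct: if two of
  them coincided, some line would contain all three.\<close>

lemma ex_line_through:
  fixes a b :: "'a::field point"
  shows "\<exists>L. lies_on a L \<and> lies_on b L"
proof (cases "a = b")
  case True
  have "pt (1, 0, 0) \<noteq> (pt (0, 1, 0) :: 'a point)"
    by (subst pt_eq_iff) (auto simp: zero_prod_def proportional_def)
  then obtain c where "c \<noteq> a" by metis
  then show ?thesis using True ex1_line[of a c] by auto
next
  case False
  then show ?thesis using ex1_line by blast
qed

text \<open>Non-collinearity makes the determinant of the three vectors nonzero, so Cramer's rule
  supplies the coefficients.\<close>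

lemma combination_if_not_collinear:
  assumes nz: "u \<noteq> 0" "v \<noteq> 0" "w \<noteq> 0" and "\<not> collinear (pt u) (pt v) (pt w)"
  obtains \<alpha> \<beta> \<gamma> where "p = \<alpha> *s u + \<beta> *s v + \<gamma> *s w"
proof -
  obtain x1 y1 z1 x2 y2 z2 x3 y3 z3 x y z where
    uvw: "u = (x1, y1, z1)" "v = (x2, y2, z2)" "w = (x3, y3, z3)" "p = (x, y, z)"
    by (cases u; cases v; cases w; cases p)
  \<comment> \<open>The cross product of \<open>v\<close> and \<open>w\<close> with its last entry
    negated, to match the sign in \<open>lies_on\<close>: it represents the line through
    \<open>pt v\<close> and \<open>pt w\<close>, and \<open>bil u l\<close> is the determinant of
    \<open>u, v, w\<close>.\<close>
  define l where "l = (y2 * z3 - z2 * y3, z2 * x3 - x2 * z3, y2 * x3 - x2 * y3)"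
  have "pt v \<noteq> pt w"
    using assms(4) ex_line_through unfolding collinear_def by metis
  then have "\<not> proportional v w"
    using nz pt_eq_iff by blast
  then have l: "l \<noteq> 0"
    using nz proportional_iff_minors[of x2 y2 z2 x3 y3 z3]
    by (auto simp: uvw l_def zero_prod_def)
  have "bil v l = 0" "bil w l = 0"
    by (auto simp: uvw l_def algebra_simps)
  then have D: "bil u l \<noteq> 0"
    using assms(4) nz l lies_on_pt unfolding collinear_def by blast
  define D where "D = bil u l"
  have "D \<noteq> 0" using D by (simp add: D_def)
  \<comment> \<open>Cramer's numerators: the determinant with \<open>p\<close> in place of
    \<open>u\<close>, \<open>v\<close>, \<open>w\<close> respectively.\<close>
  define \<alpha> where "\<alpha> = x * (y2 * z3 - z2 * y3) + y * (z2 * x3 - x2 * z3) + z * (x2 * y3 - y2 * x3)"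
  define \<beta> where "\<beta> = x * (y3 * z1 - z3 * y1) + y * (z3 * x1 - x3 * z1) + z * (x3 * y1 - y3 * x1)"
  define \<gamma> where "\<gamma> = x * (y1 * z2 - z1 * y2) + y * (z1 * x2 - x1 * z2) + z * (x1 * y2 - y1 * x2)"
  have "D * x = \<alpha> * x1 + \<beta> * x2 + \<gamma> * x3" "D * y = \<alpha> * y1 + \<beta> * y2 + \<gamma> * y3"
    "D * z = \<alpha> * z1 + \<beta> * z2 + \<gamma> * z3"
    unfolding D_def \<alpha>_def \<beta>_def \<gamma>_def l_def uvw bil.simps by algebra+
  then have "p = (\<alpha> / D) *s u + (\<beta> / D) *s v + (\<gamma> / D) *s w"
    using \<open>D \<noteq> 0\<close> by (simp add: uvw add_divide_distrib[symmetric] eq_divide_eq mult.commute)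
  then show thesis using that by blast
qed

text \<open>The vector \<open>\<beta> *s v + \<gamma> *s w\<close> equals \<open>p\<close> minus a
  multiple of \<open>u\<close>, so it lies on both lines. It cannot vanish, since then
  \<open>p\<close> would be a multiple of \<open>u\<close>.\<close>

lemma meet_cevian:
  assumes nz: "u \<noteq> 0" "v \<noteq> 0" "w \<noteq> 0" "p \<noteq> 0"
    and nc: "\<not> collinear (pt u) (pt v) (pt w)" and "pt p \<noteq> pt u"
    and p: "p = \<alpha> *s u + \<beta> *s v + \<gamma> *s w"
  shows "\<beta> *s v + \<gamma> *s w \<noteq> 0"
    and "meet (join (pt p) (pt u)) (join (pt v) (pt w)) = pt (\<beta> *s v + \<gamma> *s w)"
proof -
  let ?d = "\<beta> *s v + \<gamma> *s w"
  have pd: "p = \<alpha> *s u + ?d"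
    using p by (simp add: add.assoc)
  show d: "?d \<noteq> 0"
  proof
    assume "?d = 0"
    then have "p = \<alpha> *s u" using pd by simp
    moreover from this have "\<alpha> \<noteq> 0"
      using \<open>p \<noteq> 0\<close> by (cases u) (auto simp: zero_prod_def)
    ultimately show False
      using pt_scale \<open>u \<noteq> 0\<close> \<open>pt p \<noteq> pt u\<close> by blast
  qed
  have "pt v \<noteq> pt w"
    using nc ex_line_through unfolding collinear_def by metis
  let ?L = "join (pt p) (pt u)" and ?M = "join (pt v) (pt w)"
  have L: "lies_on (pt p) ?L" "lies_on (pt u) ?L"
    using theI'[OF ex1_line[OF \<open>pt p \<noteq> pt u\<close>]] unfolding join_def by auto
  have M: "lies_on (pt v) ?M" "lies_on (pt w) ?M"
    using theI'[OF ex1_line[OF \<open>pt v \<noteq> pt w\<close>]] unfolding join_def by auto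
  \<comment> \<open>If the lines agreed, this common line would contain all three vertices.\<close>
  have "?L \<noteq> ?M"
    using L M nc unfolding collinear_def by metis
  moreover have "lies_on (pt ?d) ?L"
  proof (rule proportion_cases[of ?L])
    fix l assume l: "l \<noteq> 0" "?L = pt l"
    then have "bil p l = 0" "bil u l = 0" using L nz by (auto simp: lies_on_pt)
    then have "bil ?d l = 0" unfolding pd by (simp add: bil_simps)
    then show ?thesis using l d by (simp add: lies_on_pt)
  qed
  moreover have "lies_on (pt ?d) ?M"
  proof (rule proportion_cases[of ?M])
    fix l assume l: "l \<noteq> 0" "?M = pt l"
    then have "bil v l = 0" "bil w l = 0" using M nz by (auto simp: lies_on_pt)
    then show ?thesis using l d by (simp add: lies_on_pt bil_simps)
  qed
  ultimately show "meet ?L ?M = pt ?d"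
    unfolding meet_def by (intro the1_equality ex1_point) auto
qed

theorem theorem78:
  fixes a0 a1 a2 a3 d1 d2 d3 :: "'a::field point"
    and r1 r2 r3 t1 t2 t3 :: 'a
  assumes "CHAR('a) \<noteq> 2"
    and "\<not> collinear a1 a2 a3"
    and "\<not> null a0" "\<not> null a1" "\<not> null a2" "\<not> null a3"
    and "a0 \<noteq> a1" "a0 \<noteq> a2" "a0 \<noteq> a3"
    and "\<not> null (join a0 a1)" "\<not> null (join a0 a2)" "\<not> null (join a0 a3)"
    and "d1 = meet (join a0 a1) (join a2 a3)"
    and "d2 = meet (join a0 a2) (join a1 a3)"
    and "d3 = meet (join a0 a3) (join a1 a2)"
    and "\<not> null d1" "\<not> null d2" "\<not> null d3"
    and "r1 = quadrance a2 d1" "t1 = quadrance d1 a3"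
    and "r2 = quadrance a3 d2" "t2 = quadrance d2 a1"
    and "r3 = quadrance a1 d3" "t3 = quadrance d3 a2"
  shows "r1 * r2 * r3 = t1 * t2 * t3"
proof -
  obtain u1 u2 u3 p where
    u: "u1 \<noteq> 0" "u2 \<noteq> 0" "u3 \<noteq> 0" "p \<noteq> 0"
    and a: "a1 = pt u1" "a2 = pt u2" "a3 = pt u3" "a0 = pt p"
    by (meson proportion_cases)
  \<comment> \<open>Each vertex in turn takes the role of \<open>u\<close> in
    \<open>meet_cevian\<close>, with the opposite side joined in the order used by the
    theorem.\<close>
  have nc: "\<not> collinear (pt u1) (pt u2) (pt u3)" "\<not> collinear (pt u2) (pt u1) (pt u3)"
    "\<not> collinear (pt u3) (pt u1) (pt u2)"
    using assms(2) unfolding a collinear_def by blast+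
  obtain x1 x2 x3 where p: "p = x1 *s u1 + x2 *s u2 + x3 *s u3"
    using combination_if_not_collinear[OF u(1-3) nc(1)] by blast
  define e1 where "e1 = x2 *s u2 + x3 *s u3"
  define e2 where "e2 = x1 *s u1 + x3 *s u3"
  define e3 where "e3 = x1 *s u1 + x2 *s u2"
  have p2: "p = x2 *s u2 + x1 *s u1 + x3 *s u3" and p3: "p = x3 *s u3 + x1 *s u1 + x2 *s u2"
    using p by (simp_all add: ac_simps)
  have e: "e1 \<noteq> 0" "e2 \<noteq> 0" "e3 \<noteq> 0"
    and d: "d1 = pt e1" "d2 = pt e2" "d3 = pt e3"
    using meet_cevian[OF u(1,2,3,4) nc(1) _ p] meet_cevian[OF u(2,1,3,4) nc(2) _ p2]
      meet_cevian[OF u(3,1,2,4) nc(3) _ p3] assms(7-9,13-15)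
    unfolding a e1_def e2_def e3_def by simp_all
  have nn: "bil u1 u1 \<noteq> 0" "bil u2 u2 \<noteq> 0" "bil u3 u3 \<noteq> 0"
    "bil e1 e1 \<noteq> 0" "bil e2 e2 \<noteq> 0" "bil e3 e3 \<noteq> 0"
    using assms(4-6,16-18) u e unfolding a d by (auto simp: null_pt)
  \<comment> \<open>\<open>quadrance_combination\<close> measures from the vertex in the first
    summand. Each foot is therefore needed in both orders, once for each end of its side.\<close>
  have e': "e1 = x3 *s u3 + x2 *s u2" "e2 = x3 *s u3 + x1 *s u1" "e3 = x2 *s u2 + x1 *s u1"
    by (simp_all add: e1_def e2_def e3_def add.commute)
  define G where "G v w = bil v v * bil w w - (bil v w)\<^sup>2" for v w :: "'a \<times> 'a \<times> 'a"
  have G: "G v w = G w v" for v w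
    by (simp add: G_def bil_commute mult.commute)
  \<comment> \<open>Each quadrance picks up the coefficient of the vertex at the other end of the
    side: \<open>r1\<close>, measured from \<open>a2\<close>, gets \<open>x3\<close>, whereas
    \<open>t1\<close>, measured from \<open>a3\<close>, gets \<open>x2\<close>.\<close>
  have r: "r1 = x3\<^sup>2 * G u2 u3 / (bil u2 u2 * bil e1 e1)"
    "r2 = x1\<^sup>2 * G u1 u3 / (bil u3 u3 * bil e2 e2)"
    "r3 = x2\<^sup>2 * G u1 u2 / (bil u1 u1 * bil e3 e3)"
    using quadrance_combination[OF u(2) e(1) nn(2,4) e1_def]
      quadrance_combination[OF u(3) e(2) nn(3,5) e'(2)]
      quadrance_combination[OF u(1) e(3) nn(1,6) e3_def] assms(19,21,23)
    unfolding a d G_def[symmetric] by (simp_all add: G[of u3 u1])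
  have t: "t1 = x2\<^sup>2 * G u2 u3 / (bil u3 u3 * bil e1 e1)"
    "t2 = x3\<^sup>2 * G u1 u3 / (bil u1 u1 * bil e2 e2)"
    "t3 = x1\<^sup>2 * G u1 u2 / (bil u2 u2 * bil e3 e3)"
    using quadrance_combination[OF u(3) e(1) nn(3,4) e'(1)]
      quadrance_combination[OF u(1) e(2) nn(1,5) e2_def]
      quadrance_combination[OF u(2) e(3) nn(2,6) e'(3)] assms(20,22,24)
    unfolding a d G_def[symmetric]
    by (simp_all add: G[of u3 u2] G[of u2 u1] quadrance_commute[of "pt e1"]
        quadrance_commute[of "pt e2"] quadrance_commute[of "pt e3"])
  show ?thesis
    \<comment> \<open>Both sides have the same factors above and below the fraction bar, only
      distributed differently.\<close>
    unfolding r t by (simp add: ac_simps)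
qed

end
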